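(* Let $(x^*,y^*,w^* )$ be an equilibrium of the generalized Nash equilibrium problem (GNEP). Suppose that, for every $i\in I(x^*,w^* )$, there exists an open neighborhood $N^*$ of $x^*$ such that $g_i(x,w^* )\le 0$ for all $x\in N^*$ for which there exists $y$ with $(x,y)\in W$ and $F(x,y)\le F(x^*,y^* )$. Then $(x^*,y^* )$ is a strong local solution of the standard optimistic bilevel problem (SBP).
   Context: Data and standing assumptions: $F,f:\mathbb{R}^{n_1}\times\mathbb{R}^{n_2}\to\mathbb{R}$ and $g=(g_1,\dots,g_m):\mathbb{R}^{n_1}\times\mathbb{R}^{n_2}\to\mathbb{R}^m$ are continuous; $X\subseteq\mathbb{R}^{n_1}$ and $U\subseteq\mathbb{R}^{n_2}$ are closed. Vector inequalities are componentwise. The active index set is $I(x,y):=\{i\in\{1,\dots,m\}: g_i(x,y)=0\}$. Let $K(x):=\{v\in\mathbb{R}^{n_2}: g(x,v)\le 0\}$ and let $S(x)$ be the set of global minimizers of $w\mapsto f(x,w)$ over $w\in U\cap K(x)$ (empty if there are none). SBP: minimize $F(x,y)$ over $(x,y)\in W$, where $W:=\{(x,y): x\in X,\ y\in S(x)\}$. A point $(x^*,y^* )$ is a strong local solution of the SBP if $(x^*,y^* )\in W$ and there is an open neighborhood $N$ of $x^*$ in $\mathbb{R}^{n_1}$ such that $F(x^*,y^* )\le F(x,y)$ for all $(x,y)\in W\cap(N\times\mathbb{R}^{n_2})$. GNEP: a two-player game in which the leader controls $(x,y)$ and minimizes $F(x,y)$ subject to $(x,y)\in X\times U$, $f(x,y)\le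 f(x,w)$, $g(x,y)\le 0$, while the follower controls $w$ and minimizes $f(x,w)$ subject to $w\in U$, $g(x,w)\le 0$. For $w\in\mathbb{R}^{n_2}$ put $V(w):=\{(u,v)\in X\times U: f(u,v)\le f(u,w),\ g(u,v)\le 0\}$. An equilibrium (solution) of the GNEP is a triple $(x^*,y^*,w^* )$ such that $(x^*,y^* )\in V(w^* )$; $F(x^*,y^* )\le F(x,y)$ for all $(x,y)\in V(w^* )$; $w^*\in U\cap K(x^* )$; and $f(x^*,w^* )\le f(x^*,w)$ for all $w\in U\cap K(x^* )$. *)

theory Defs
  imports "HOL-Analysis.Analysis"
begin

(* The library order on real ^ 'm is componentwise (less_eq_vec_def), so
   g (x, y) \<le> 0 is the vector inequality of the problem. *)

definition active_set ::
    "((real^'n1) \<times> (real^'n2) \<Rightarrow> real^'m) \<Rightarrow> real^'n1 \<Rightarrow> real^'n2 \<Rightarrow> 'm set" where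
  "active_set g x y = {i. g (x, y) $ i = 0}"

definition K_set ::
    "((real^'n1) \<times> (real^'n2) \<Rightarrow> real^'m) \<Rightarrow> real^'n1 \<Rightarrow> (real^'n2) set" where
  "K_set g x = {v. g (x, v) \<le> 0}"

definition S_set ::
    "(real^'n2) set \<Rightarrow> ((real^'n1) \<times> (real^'n2) \<Rightarrow> real) \<Rightarrow>
     ((real^'n1) \<times> (real^'n2) \<Rightarrow> real^'m) \<Rightarrow> real^'n1 \<Rightarrow> (real^'n2) set" where
  "S_set U f g x = {y \<in> U \<inter> K_set g x. \<forall>w \<in> U \<inter> K_set g x. f (x, y) \<le> f (x, w)}"

definition W_set ::
    "(real^'n1) set \<Rightarrow> (real^'n2) set \<Rightarrow> ((real^'n1) \<times> (real^'n2) \<Rightarrow> real) \<Rightarrow>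
     ((real^'n1) \<times> (real^'n2) \<Rightarrow> real^'m) \<Rightarrow> ((real^'n1) \<times> (real^'n2)) set" where
  "W_set X U f g = {(x, y). x \<in> X \<and> y \<in> S_set U f g x}"

(* The neighbourhood N restricts the leader variable x only; y is unrestricted. *)
definition SBP_strong_local_solution ::
    "(real^'n1) set \<Rightarrow> (real^'n2) set \<Rightarrow> ((real^'n1) \<times> (real^'n2) \<Rightarrow> real) \<Rightarrow>
     ((real^'n1) \<times> (real^'n2) \<Rightarrow> real) \<Rightarrow> ((real^'n1) \<times> (real^'n2) \<Rightarrow> real^'m) \<Rightarrow>
     real^'n1 \<Rightarrow> real^'n2 \<Rightarrow> bool" where
  "SBP_strong_local_solution X U F f g xs ys \<longleftrightarrow>
     (xs, ys) \<in> W_set X U f g \<and>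
     (\<exists>N. open N \<and> xs \<in> N \<and>
       (\<forall>(x, y) \<in> W_set X U f g \<inter> (N \<times> UNIV). F (xs, ys) \<le> F (x, y)))"

definition V_set ::
    "(real^'n1) set \<Rightarrow> (real^'n2) set \<Rightarrow> ((real^'n1) \<times> (real^'n2) \<Rightarrow> real) \<Rightarrow>
     ((real^'n1) \<times> (real^'n2) \<Rightarrow> real^'m) \<Rightarrow> real^'n2 \<Rightarrow> ((real^'n1) \<times> (real^'n2)) set" where
  "V_set X U f g w = {(u, v) \<in> X \<times> U. f (u, v) \<le> f (u, w) \<and> g (u, v) \<le> 0}"

definition GNEP_equilibrium ::
    "(real^'n1) set \<Rightarrow> (real^'n2) set \<Rightarrow> ((real^'n1) \<times> (real^'n2) \<Rightarrow> real) \<Rightarrow>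
     ((real^'n1) \<times> (real^'n2) \<Rightarrow> real) \<Rightarrow> ((real^'n1) \<times> (real^'n2) \<Rightarrow> real^'m) \<Rightarrow>
     real^'n1 \<Rightarrow> real^'n2 \<Rightarrow> real^'n2 \<Rightarrow> bool" where
  "GNEP_equilibrium X U F f g xs ys ws \<longleftrightarrow>
     (xs, ys) \<in> V_set X U f g ws \<and>
     (\<forall>(x, y) \<in> V_set X U f g ws. F (xs, ys) \<le> F (x, y)) \<and>
     ws \<in> U \<inter> K_set g xs \<and>
     (\<forall>w \<in> U \<inter> K_set g xs. f (xs, ws) \<le> f (xs, w))"

end

(* The only obstruction to comparing (xs, ys) with a nearby bilevel feasible point (x, y)
   is that ws may be infeasible for the follower at x. Inactive constraints at (xs, ws) stay
   satisfied near xs by continuity, and the active ones are covered by the hypothesis at every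
   x that could beat (xs, ys). So ws is feasible at such x, whence (x, y) lies in V(ws) and
   the leader's optimality in the GNEP applies. *)
theory Submission
  imports Defs
begin

theorem theorem3p14:
  fixes F f :: "(real^'n1) \<times> (real^'n2) \<Rightarrow> real"
    and g :: "(real^'n1) \<times> (real^'n2) \<Rightarrow> real^'m"
    and X :: "(real^'n1) set" and U :: "(real^'n2) set"
    and xs :: "real^'n1" and ys ws :: "real^'n2"
  assumes "continuous_on UNIV F" and "continuous_on UNIV f" and "continuous_on UNIV g"
    and "closed X" and "closed U"
    and "GNEP_equilibrium X U F f g xs ys ws"
    and "\<forall>i \<in> active_set g xs ws. \<exists>N. open N \<and> xs \<in> N \<and>
           (\<forall>x \<in> N. (\<exists>y. (x, y) \<in> W_set X U f g \<and> F (x, y) \<le> F (xs, ys)) \<longrightarrow>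
              g (x, ws) $ i \<le> 0)"
  shows "SBP_strong_local_solution X U F f g xs ys"
proof -
  have V: "(xs, ys) \<in> V_set X U f g ws"
    and opt: "\<And>x y. (x, y) \<in> V_set X U f g ws \<Longrightarrow> F (xs, ys) \<le> F (x, y)"
    and ws: "ws \<in> U" "g (xs, ws) \<le> 0"
    and wopt: "\<And>w. w \<in> U \<inter> K_set g xs \<Longrightarrow> f (xs, ws) \<le> f (xs, w)"
    using assms(6) unfolding GNEP_equilibrium_def K_set_def by auto
  \<comment> \<open>Membership of \<open>(xs, ys)\<close> in \<open>V(ws)\<close> gives
    \<open>f (xs, ys) \<le> f (xs, ws)\<close>, and \<open>ws\<close> is already optimal for the
    follower at \<open>xs\<close>, so \<open>ys\<close> is optimal too.\<close>
  have W: "(xs, ys) \<in> W_set X U f g"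
    using V wopt unfolding V_set_def W_set_def S_set_def K_set_def
    by (auto intro: order_trans)
  define better where
    "better x \<longleftrightarrow> (\<exists>y. (x, y) \<in> W_set X U f g \<and> F (x, y) \<le> F (xs, ys))" for x
  have "\<forall>\<^sub>F x in nhds xs. better x \<longrightarrow> g (x, ws) $ i \<le> 0" for i
  proof (cases "i \<in> active_set g xs ws")
    case True
    then show ?thesis
      using assms(7) unfolding eventually_nhds better_def by blast
  next
    case False
    then have neg: "g (xs, ws) $ i < 0"
      using ws(2) by (auto simp: active_set_def less_eq_vec_def order_less_le)
    have "continuous_on UNIV (\<lambda>x. g (x, ws) $ i)"
      by (intro continuous_intros continuous_on_compose2[OF assms(3)]) auto
    then have "open {x. g (x, ws) $ i < 0}"
      by (intro open_Collect_less continuous_on_const)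
    then have "\<forall>\<^sub>F x in nhds xs. x \<in> {x. g (x, ws) $ i < 0}"
      using neg by (intro eventually_nhds_in_open) auto
    then show ?thesis
      by (rule eventually_mono) simp
  qed
  \<comment> \<open>The neighbourhood found so far depends on \<open>i\<close>; as the index type is
    finite, one neighbourhood serves all constraints.\<close>
  then have "\<forall>\<^sub>F x in nhds xs. \<forall>i. better x \<longrightarrow> g (x, ws) $ i \<le> 0"
    by (intro eventually_all_finite) auto
  then obtain N where N: "open N" "xs \<in> N"
    and feas: "\<And>x. x \<in> N \<Longrightarrow> better x \<Longrightarrow> g (x, ws) \<le> 0"
    unfolding eventually_nhds less_eq_vec_def by auto
  have "F (xs, ys) \<le> F (x, y)" if xy: "(x, y) \<in> W_set X U f g" and x: "x \<in> N" for x y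
  proof (cases "F (x, y) \<le> F (xs, ys)")
    case True
    then have "g (x, ws) \<le> 0"
      using feas x xy unfolding better_def by blast
    \<comment> \<open>Now \<open>ws\<close> competes with \<open>y\<close> in the follower's problem
      at \<open>x\<close>, so the optimality of \<open>y\<close> yields
      \<open>f (x, y) \<le> f (x, ws)\<close>.\<close>
    then have "(x, y) \<in> V_set X U f g ws"
      using xy ws(1) unfolding W_set_def S_set_def K_set_def V_set_def by auto
    then show ?thesis by (rule opt)
  qed simp
  then show ?thesis
    using W N unfolding SBP_strong_local_solution_def by blast
qed

end
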